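(* Let $\alpha$ be a $C^3$ regular twisted curve in $\mathbb{E}^3$ parameterized by arc-length, with curvature $\kappa_\alpha=\kappa>0$ and torsion $\tau_\alpha=\tau\neq0$. Let $P_S(s)$ and $R_S(s)$ be the center and radius of the osculating sphere of $\alpha$ at $\alpha(s)$. Fix $s_0$, put $a_0=P_S(s_0)$, $r_0=R_S(s_0)$, and let $$\beta(t)=a_0+r_0\frac{\alpha(t)-a_0}{\Vert\alpha(t)-a_0\Vert},\qquad t\in(s_0-\epsilon,s_0+\epsilon),$$ be the projection of $\alpha$ near $\alpha(s_0)$ onto its osculating sphere at $\alpha(s_0)$, with curvature $\kappa_\beta$ and torsion $\tau_\beta$. Then $$\kappa_\alpha(s_0)=\kappa_\beta(s_0)\quad\text{and}\quad\tau_\alpha(s_0)=\tau_\beta(s_0).$$ Consequently, $$\kappa_\alpha(s_0)=\frac{1}{R_S(s_0)}\sqrt{1+J^2(s_0)}$$ and $$\tau_\alpha(s_0)=\frac{\langle\alpha(s_0)-P_S(s_0),\alpha'(s_0)\times\alpha'''(s_0)\rangle}{1+J^2(s_0)}=\frac{J'(s_0)}{1+J^2(s_0)}+\frac{\kappa(s_0)\,\varsigma(s_0)}{1+J^2(s_0)},$$ where $$J(s)=\langle\alpha(s)-P_S(s),\alpha'(s)\times\alpha''(s)\rangle,\qquad \varsigma(s)=\tau(s)\rho(s)+\frac{\mathrm{d}}{\mathrm{d}s}\left(\frac{\rho'(s)}{\tau(s)}\right),\qquad \rho=\frac1\kappa.$$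
   Context: $\mathbb{E}^3$ is $\mathbb{R}^3$ with the standard Euclidean inner product $\langle\cdot,\cdot\rangle$. The Frenet frame $\{\mathbf{t},\mathbf{n},\mathbf{b}\}$ satisfies $\mathbf{t}'=\kappa\mathbf{n}$, $\mathbf{n}'=-\kappa\mathbf{t}+\tau\mathbf{b}$, $\mathbf{b}'=-\tau\mathbf{n}$. A curve is twisted if $\kappa>0$ and $\tau\neq0$. The osculating sphere at a point is the sphere having contact of order 3 with the curve there; its center and radius are $$P_S=\alpha+\frac1\kappa\mathbf{n}+\frac1\tau\frac{\mathrm{d}}{\mathrm{d}s}\left(\frac1\kappa\right)\mathbf{b},\qquad R_S=\sqrt{\frac1{\kappa^2}+\frac1{\tau^2}\left[\frac{\mathrm{d}}{\mathrm{d}s}\left(\frac1\kappa\right)\right]^2}.$$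
   Formalization: The last equality, with J'(s_0) and ς(s_0), is stated under the condition that ρ'/τ is differentiable at s_0, since for a curve that is only C^3 these derivatives need not exist; differentiability of J at s_0 is then proved. *)

theory Defs
  imports "HOL-Analysis.Analysis"
begin

unbundle cross3_syntax

definition vderiv :: "(real \<Rightarrow> 'a::real_normed_vector) \<Rightarrow> real \<Rightarrow> 'a"
  where "vderiv f t = vector_derivative f (at t)"

text \<open>The class \<open>C\<^sup>k\<close>; \<open>S\<close> is meant to be open, since the derivatives are two-sided.\<close>

primrec Ck_on :: "nat \<Rightarrow> (real \<Rightarrow> 'a::real_normed_vector) \<Rightarrow> real set \<Rightarrow> bool"
  where
    "Ck_on 0 f S \<longleftrightarrow> continuous_on S f"
  | "Ck_on (Suc k) f S \<longleftrightarrow> (\<forall>t\<in>S. f differentiable (at t)) \<and> Ck_on k (vderiv f) S"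

text \<open>The derivative \<open>d/ds = |\<gamma>'|\<^sup>-\<^sup>1 d/dt\<close> of \<open>f\<close> with respect to the arc length \<open>s\<close>
  of a regular curve \<open>\<gamma>\<close> with arbitrary parameter \<open>t\<close>. It makes the Frenet apparatus
  below available for curves that are not parameterized by arc length; if
  \<open>|\<gamma>'| = 1\<close> then it is the ordinary derivative.\<close>

definition arc_deriv :: "(real \<Rightarrow> real^3) \<Rightarrow> (real \<Rightarrow> 'a::real_normed_vector) \<Rightarrow> real \<Rightarrow> 'a"
  where "arc_deriv \<gamma> f t = vderiv f t /\<^sub>R norm (vderiv \<gamma> t)"

definition tangent :: "(real \<Rightarrow> real^3) \<Rightarrow> real \<Rightarrow> real^3"
  where "tangent \<gamma> = arc_deriv \<gamma> \<gamma>"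

definition curvature :: "(real \<Rightarrow> real^3) \<Rightarrow> real \<Rightarrow> real"
  where "curvature \<gamma> t = norm (arc_deriv \<gamma> (tangent \<gamma>) t)"

definition normal :: "(real \<Rightarrow> real^3) \<Rightarrow> real \<Rightarrow> real^3"
  where "normal \<gamma> t = arc_deriv \<gamma> (tangent \<gamma>) t /\<^sub>R curvature \<gamma> t"

definition binormal :: "(real \<Rightarrow> real^3) \<Rightarrow> real \<Rightarrow> real^3"
  where "binormal \<gamma> t = tangent \<gamma> t \<times> normal \<gamma> t"

text \<open>From the Frenet equation \<open>db/ds = - \<tau> n\<close>.\<close>

definition torsion :: "(real \<Rightarrow> real^3) \<Rightarrow> real \<Rightarrow> real"
  where "torsion \<gamma> t = - (arc_deriv \<gamma> (binormal \<gamma>) t \<bullet> normal \<gamma> t)"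

definition curvature_radius :: "(real \<Rightarrow> real^3) \<Rightarrow> real \<Rightarrow> real"
  where "curvature_radius \<gamma> t = 1 / curvature \<gamma> t"

text \<open>Center and radius of the osculating sphere. The lemmas \<open>osculating_sphere_contact\<close> and
  \<open>osculating_sphere_unique\<close> below show, for twisted unit-speed \<open>C\<^sup>3\<close> curves, that these
  formulas give the unique sphere having contact of order 3 with the curve.\<close>

definition osculating_center :: "(real \<Rightarrow> real^3) \<Rightarrow> real \<Rightarrow> real^3"
  where "osculating_center \<gamma> t =
    \<gamma> t + curvature_radius \<gamma> t *\<^sub>R normal \<gamma> t
        + (1 / torsion \<gamma> t * arc_deriv \<gamma> (curvature_radius \<gamma>) t) *\<^sub>R binormal \<gamma> t"

definition osculating_radius :: "(real \<Rightarrow> real^3) \<Rightarrow> real \<Rightarrow> real"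
  where "osculating_radius \<gamma> t =
    sqrt (1 / (curvature \<gamma> t)\<^sup>2
        + 1 / (torsion \<gamma> t)\<^sup>2 * (arc_deriv \<gamma> (curvature_radius \<gamma>) t)\<^sup>2)"

text \<open>Here \<open>\<alpha>\<close> is meant to be parameterized by arc length.\<close>

definition osculating_J :: "(real \<Rightarrow> real^3) \<Rightarrow> real \<Rightarrow> real"
  where "osculating_J \<alpha> s =
    (\<alpha> s - osculating_center \<alpha> s) \<bullet> (vderiv \<alpha> s \<times> vderiv (vderiv \<alpha>) s)"

definition varsigma :: "(real \<Rightarrow> real^3) \<Rightarrow> real \<Rightarrow> real"
  where "varsigma \<alpha> s = torsion \<alpha> s * curvature_radius \<alpha> s
    + arc_deriv \<alpha> (\<lambda>u. arc_deriv \<alpha> (curvature_radius \<alpha>) u / torsion \<alpha> u) s"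


text \<open>Contact of order \<open>k\<close> of \<open>\<gamma>\<close> with the sphere \<open>|x - P| = R\<close> at \<open>\<gamma> t\<close>.\<close>

definition sphere_contact :: "nat \<Rightarrow> (real \<Rightarrow> real^3) \<Rightarrow> real \<Rightarrow> real^3 \<Rightarrow> real \<Rightarrow> bool"
  where "sphere_contact k \<gamma> t P R \<longleftrightarrow>
    (\<forall>j\<le>k. (vderiv ^^ j) (\<lambda>u. (norm (\<gamma> u - P))\<^sup>2 - R\<^sup>2) t = 0)"

lemma vderiv_eqI: "(f has_vector_derivative D) (at t) \<Longrightarrow> vderiv f t = D"
  by (simp add: vderiv_def vector_derivative_at)

lemma vderiv_cong:
  assumes "open S" "t \<in> S" "\<And>u. u \<in> S \<Longrightarrow> f u = g u"
  shows "vderiv f t = vderiv g t"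
proof -
  have "(f has_vector_derivative D) (at t) = (g has_vector_derivative D) (at t)" for D
    using assms by (metis has_vector_derivative_transform_within_open)
  then show ?thesis by (simp add: vderiv_def vector_derivative_def)
qed

lemma has_vector_derivative_vderiv:
  "f differentiable (at t) \<Longrightarrow> (f has_vector_derivative vderiv f t) (at t)"
  by (simp add: vderiv_def vector_derivative_works)

lemma has_vector_derivative_cross:
  fixes f g :: "real \<Rightarrow> real^3"
  assumes "(f has_vector_derivative f') (at t)" "(g has_vector_derivative g') (at t)"
  shows "((\<lambda>u. f u \<times> g u) has_vector_derivative (f t \<times> g' + f' \<times> g t)) (at t)"
proof -
  have "bounded_bilinear cross3"
    using bilinear_conv_bounded_bilinear bilinear_cross by blast
  from bounded_bilinear.has_vector_derivative[OF this assms] show ?thesis .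
qed

lemma has_real_derivative_inner:
  fixes f g :: "real \<Rightarrow> 'a::real_inner"
  assumes "(f has_vector_derivative f') (at t)" "(g has_vector_derivative g') (at t)"
  shows "((\<lambda>u. f u \<bullet> g u) has_real_derivative (f t \<bullet> g' + f' \<bullet> g t)) (at t)"
  unfolding has_real_derivative_iff_has_vector_derivative
  by (rule bounded_bilinear.has_vector_derivative[OF bounded_bilinear_inner assms])

locale twisted_unit_speed =
  fixes \<alpha> :: "real \<Rightarrow> real^3" and I :: "real set"
  assumes I: "open I" and C3: "Ck_on 3 \<alpha> I"
    and unit: "\<forall>s\<in>I. norm (vderiv \<alpha> s) = 1"
    and twisted: "\<forall>s\<in>I. curvature \<alpha> s > 0 \<and> torsion \<alpha> s \<noteq> 0"
begin

abbreviation "v1 \<equiv> vderiv \<alpha>"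
abbreviation "v2 \<equiv> vderiv v1"
abbreviation "v3 \<equiv> vderiv v2"

lemma d1: "s \<in> I \<Longrightarrow> (\<alpha> has_vector_derivative v1 s) (at s)"
  and d2: "s \<in> I \<Longrightarrow> (v1 has_vector_derivative v2 s) (at s)"
  and d3: "s \<in> I \<Longrightarrow> (v2 has_vector_derivative v3 s) (at s)"
  using C3 by (auto simp: numeral_3_eq_3 intro!: has_vector_derivative_vderiv)

lemma arc: "s \<in> I \<Longrightarrow> arc_deriv \<alpha> f s = vderiv f s"
  using unit by (simp add: arc_deriv_def)

lemma tangent_eq: "s \<in> I \<Longrightarrow> tangent \<alpha> s = v1 s"
  by (simp add: tangent_def arc)

lemma dtangent_eq: "s \<in> I \<Longrightarrow> arc_deriv \<alpha> (tangent \<alpha>) s = v2 s"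
  by (simp add: arc vderiv_cong[OF I _ tangent_eq])

lemma curvature_eq: "s \<in> I \<Longrightarrow> curvature \<alpha> s = norm (v2 s)"
  by (simp add: curvature_def dtangent_eq)

lemma normal_eq: "s \<in> I \<Longrightarrow> normal \<alpha> s = v2 s /\<^sub>R norm (v2 s)"
  by (simp add: normal_def dtangent_eq curvature_eq)

lemma v2_pos: "s \<in> I \<Longrightarrow> norm (v2 s) > 0"
  using twisted curvature_eq by metis

lemma binormal_eq: "s \<in> I \<Longrightarrow> binormal \<alpha> s = (1 / norm (v2 s)) *\<^sub>R (v1 s \<times> v2 s)"
  by (simp add: binormal_def tangent_eq normal_eq cross_mult_right divide_inverse)

lemma v11: "s \<in> I \<Longrightarrow> v1 s \<bullet> v1 s = 1"
  using unit by (simp add: dot_square_norm)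

lemma v12: assumes "s \<in> I" shows "v1 s \<bullet> v2 s = 0"
proof -
  have "((\<lambda>u. v1 u \<bullet> v1 u) has_real_derivative (v1 s \<bullet> v2 s + v2 s \<bullet> v1 s)) (at s)"
    by (intro has_real_derivative_inner d2 assms)
  moreover have "((\<lambda>u. v1 u \<bullet> v1 u) has_real_derivative 0) (at s)"
    by (rule has_field_derivative_transform_within_open[of "\<lambda>_. 1", OF _ I assms])
       (auto simp: v11)
  ultimately have "v1 s \<bullet> v2 s + v2 s \<bullet> v1 s = 0" by (rule DERIV_unique)
  then show ?thesis by (simp add: inner_commute)
qed

lemma dnorm2: assumes "s \<in> I"
  shows "((\<lambda>u. norm (v2 u)) has_real_derivative (v2 s \<bullet> v3 s) / norm (v2 s)) (at s)"
proof -
  have "v2 s \<bullet> v2 s > 0" using v2_pos[OF assms] by auto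
  then have "((\<lambda>u. sqrt (v2 u \<bullet> v2 u)) has_real_derivative (v2 s \<bullet> v3 s) / norm (v2 s)) (at s)"
    by (auto intro!: derivative_eq_intros has_real_derivative_inner d3 assms
        simp: norm_eq_sqrt_inner inner_commute field_simps simp del: inner_gt_zero_iff)
  then show ?thesis by (simp add: norm_eq_sqrt_inner)
qed

lemma torsion_eq: assumes s: "s \<in> I"
  shows "torsion \<alpha> s = (v1 s \<times> v2 s) \<bullet> v3 s / (norm (v2 s))\<^sup>2"
proof -
  let ?k = "norm (v2 s)"
  have k: "?k > 0" using v2_pos s .
  have "((\<lambda>u. 1 / norm (v2 u)) has_real_derivative - ((v2 s \<bullet> v3 s) / ?k) / ?k\<^sup>2) (at s)"
    using k by (auto intro!: derivative_eq_intros dnorm2 s simp: power2_eq_square)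
  then have "((\<lambda>u. (1 / norm (v2 u)) *\<^sub>R (v1 u \<times> v2 u)) has_vector_derivative
     ((1 / ?k) *\<^sub>R (v1 s \<times> v3 s + v2 s \<times> v2 s) + (- ((v2 s \<bullet> v3 s) / ?k) / ?k\<^sup>2) *\<^sub>R (v1 s \<times> v2 s))) (at s)"
    by (intro has_vector_derivative_scaleR has_vector_derivative_cross d2 d3 s)
  then have "arc_deriv \<alpha> (binormal \<alpha>) s =
     (1 / ?k) *\<^sub>R (v1 s \<times> v3 s) + (- ((v2 s \<bullet> v3 s) / ?k) / ?k\<^sup>2) *\<^sub>R (v1 s \<times> v2 s)"
    by (simp add: arc s vderiv_cong[OF I s binormal_eq] vderiv_eqI)
  then have "torsion \<alpha> s = - ((v1 s \<times> v3 s) \<bullet> v2 s) / ?k\<^sup>2"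
    using dot_cross_self(3)[of "v1 s" "v2 s"]
    by (simp only: torsion_def normal_eq[OF s] inner_add_left inner_scaleR_left inner_scaleR_right)
       (simp add: power2_eq_square divide_inverse)
  also have "(v1 s \<times> v3 s) \<bullet> v2 s = - ((v1 s \<times> v2 s) \<bullet> v3 s)"
    by (simp add: cross3_simps)
  finally show ?thesis by simp
qed

lemma triple_nz: "s \<in> I \<Longrightarrow> (v1 s \<times> v2 s) \<bullet> v3 s \<noteq> 0"
  using torsion_eq twisted by fastforce

lemma dradius: assumes s: "s \<in> I"
  shows "arc_deriv \<alpha> (curvature_radius \<alpha>) s = - (v2 s \<bullet> v3 s) / norm (v2 s) ^ 3"
proof -
  have "((\<lambda>u. 1 / norm (v2 u)) has_real_derivative - (v2 s \<bullet> v3 s) / norm (v2 s) ^ 3) (at s)"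
    using v2_pos[OF s] by (auto intro!: derivative_eq_intros dnorm2 s simp: power3_eq_cube)
  moreover have "vderiv (curvature_radius \<alpha>) s = vderiv (\<lambda>u. 1 / norm (v2 u)) s"
    by (rule vderiv_cong[OF I s]) (simp add: curvature_radius_def curvature_eq)
  ultimately show ?thesis
    by (simp add: arc s vderiv_eqI has_real_derivative_iff_has_vector_derivative)
qed

lemma contact_iff: assumes s: "s \<in> I"
  shows "sphere_contact 3 \<alpha> s P R \<longleftrightarrow> (norm (\<alpha> s - P))\<^sup>2 = R\<^sup>2 \<and> (\<alpha> s - P) \<bullet> v1 s = 0
    \<and> (\<alpha> s - P) \<bullet> v2 s = - 1 \<and> (\<alpha> s - P) \<bullet> v3 s = 0"
proof -
  let ?f = "\<lambda>u. (norm (\<alpha> u - P))\<^sup>2 - R\<^sup>2"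
  have q: "((\<lambda>u. \<alpha> u - P) has_vector_derivative v1 u) (at u)" if "u \<in> I" for u
    using has_vector_derivative_diff[OF d1[OF that] has_vector_derivative_const[of P]] by simp
  have real_vderiv: "vderiv g u = D" if "(g has_real_derivative D) (at u)" for g :: "real \<Rightarrow> real" and D u
    using that by (intro vderiv_eqI) (simp only: has_real_derivative_iff_has_vector_derivative)
  have f1: "vderiv ?f u = 2 * ((\<alpha> u - P) \<bullet> v1 u)" if u: "u \<in> I" for u
  proof -
    have "((\<lambda>u. (\<alpha> u - P) \<bullet> (\<alpha> u - P) - R\<^sup>2) has_real_derivative
        ((\<alpha> u - P) \<bullet> v1 u + v1 u \<bullet> (\<alpha> u - P)) - 0) (at u)"
      by (rule DERIV_diff[OF has_real_derivative_inner[OF q[OF u] q[OF u]] DERIV_const])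
    from real_vderiv[OF this] show ?thesis
      by (simp add: power2_norm_eq_inner inner_commute)
  qed
  have f2: "vderiv (vderiv ?f) u = 2 * ((\<alpha> u - P) \<bullet> v2 u + 1)" if u: "u \<in> I" for u
  proof -
    have "((\<lambda>u. 2 * ((\<alpha> u - P) \<bullet> v1 u)) has_real_derivative
        2 * ((\<alpha> u - P) \<bullet> v2 u + v1 u \<bullet> v1 u)) (at u)"
      by (rule DERIV_cmult[OF has_real_derivative_inner[OF q[OF u] d2[OF u]]])
    from real_vderiv[OF this] show ?thesis
      by (simp only: vderiv_cong[OF I u f1] v11[OF u])
  qed
  have f3: "vderiv (vderiv (vderiv ?f)) s = 2 * ((\<alpha> s - P) \<bullet> v3 s)"
  proof -
    have "((\<lambda>u. 2 * ((\<alpha> u - P) \<bullet> v2 u + 1)) has_real_derivative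
        2 * (((\<alpha> s - P) \<bullet> v3 s + v1 s \<bullet> v2 s) + 0)) (at s)"
      by (rule DERIV_cmult[OF DERIV_add[OF has_real_derivative_inner[OF q[OF s] d3[OF s]] DERIV_const]])
    from real_vderiv[OF this] show ?thesis
      by (simp only: vderiv_cong[OF I s f2] v12[OF s] add_0_right)
  qed
  have *: "(\<forall>j\<le>3. Q j) \<longleftrightarrow> Q 0 \<and> Q (Suc 0) \<and> Q (Suc (Suc 0)) \<and> Q (Suc (Suc (Suc 0)))" for Q :: "nat \<Rightarrow> bool"
    by (auto simp: numeral_3_eq_3 le_Suc_eq)
  show ?thesis
    unfolding sphere_contact_def * funpow.simps comp_apply id_apply f1[OF s] f2[OF s] f3
    by auto
qed

lemma osculating_sphere_contact: assumes s: "s \<in> I"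
  shows "osculating_radius \<alpha> s > 0"
    and "sphere_contact 3 \<alpha> s (osculating_center \<alpha> s) (osculating_radius \<alpha> s)"
proof -
  let ?k = "norm (v2 s)" and ?D = "(v1 s \<times> v2 s) \<bullet> v3 s" and ?e = "v2 s \<bullet> v3 s"
  have k: "?k > 0" using v2_pos s .
  have D: "?D \<noteq> 0" using triple_nz s .
  define c where "c = (1 / torsion \<alpha> s * arc_deriv \<alpha> (curvature_radius \<alpha>) s)"
  have c: "c = - ?e / (?D * ?k)"
    unfolding c_def torsion_eq[OF s] dradius[OF s] using k D
    by (simp add: field_simps power2_eq_square power3_eq_cube)
  have q: "\<alpha> s - osculating_center \<alpha> s = - ((1 / ?k\<^sup>2) *\<^sub>R v2 s + (c / ?k) *\<^sub>R (v1 s \<times> v2 s))"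
    unfolding osculating_center_def c_def[symmetric]
    by (simp add: binormal_eq normal_eq s curvature_radius_def curvature_eq power2_eq_square divide_inverse)
  have R2: "1 / (curvature \<alpha> s)\<^sup>2 + 1 / (torsion \<alpha> s)\<^sup>2 * (arc_deriv \<alpha> (curvature_radius \<alpha>) s)\<^sup>2
      = 1 / ?k\<^sup>2 + c\<^sup>2"
    by (simp add: curvature_eq s c_def power_divide)
  have pos: "1 / ?k\<^sup>2 + c\<^sup>2 > 0" using k by (intro add_pos_nonneg) auto
  show "osculating_radius \<alpha> s > 0"
    unfolding osculating_radius_def R2 using pos by simp
  have Rsq: "(osculating_radius \<alpha> s)\<^sup>2 = 1 / ?k\<^sup>2 + c\<^sup>2"
    unfolding osculating_radius_def R2 using pos by simp
  have k2: "v2 s \<bullet> v2 s = ?k\<^sup>2" by (simp add: power2_norm_eq_inner)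
  have "(norm (v1 s \<times> v2 s))\<^sup>2 = ?k\<^sup>2"
    using unit s by (simp add: norm_cross v12)
  then have b2: "(v1 s \<times> v2 s) \<bullet> (v1 s \<times> v2 s) = ?k\<^sup>2" by (simp add: power2_norm_eq_inner)
  have "(norm (\<alpha> s - osculating_center \<alpha> s))\<^sup>2 = (osculating_radius \<alpha> s)\<^sup>2"
    unfolding Rsq power2_norm_eq_inner[of "\<alpha> s - osculating_center \<alpha> s"]
    unfolding q inner_minus_left inner_minus_right inner_add_left inner_add_right
      inner_scaleR_left inner_scaleR_right dot_cross_self k2 b2 using k
    by (simp add: field_simps power2_eq_square)
  moreover have "(\<alpha> s - osculating_center \<alpha> s) \<bullet> v1 s = 0"
    unfolding q inner_minus_left inner_add_left inner_scaleR_left dot_cross_self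
    using v12[OF s] by (simp add: inner_commute)
  moreover have "(\<alpha> s - osculating_center \<alpha> s) \<bullet> v2 s = - 1"
    unfolding q inner_minus_left inner_add_left inner_scaleR_left dot_cross_self k2
    using k by simp
  moreover have "(\<alpha> s - osculating_center \<alpha> s) \<bullet> v3 s = 0"
    unfolding q c inner_minus_left inner_add_left inner_scaleR_left
    using k D by (simp add: field_simps power2_eq_square)
  ultimately show "sphere_contact 3 \<alpha> s (osculating_center \<alpha> s) (osculating_radius \<alpha> s)"
    by (simp add: contact_iff s)
qed

lemma osculating_sphere_unique: assumes s: "s \<in> I" and R: "R > 0" and c: "sphere_contact 3 \<alpha> s P R"
  shows "P = osculating_center \<alpha> s \<and> R = osculating_radius \<alpha> s"
proof -
  let ?C = "osculating_center \<alpha> s"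
  note c1 = c[unfolded contact_iff[OF s]]
  note c2 = osculating_sphere_contact(2)[OF s, unfolded contact_iff[OF s]]
  define d where "d = P - ?C"
  have d: "d \<bullet> v1 s = 0" "d \<bullet> v2 s = 0" "d \<bullet> v3 s = 0"
    using c1 c2 by (simp_all add: d_def inner_diff_left)
  have cramer: "((x \<times> y) \<bullet> z) *\<^sub>R d = (d \<bullet> x) *\<^sub>R (y \<times> z) + (d \<bullet> y) *\<^sub>R (z \<times> x) + (d \<bullet> z) *\<^sub>R (x \<times> y)"
    for x y z :: "real^3"
    by (simp add: vec_eq_iff forall_3 cross_components inner_vec_def sum_3) (intro conjI; algebra)
  have "d = 0" using cramer[of "v1 s" "v2 s" "v3 s"] d triple_nz[OF s] by simp
  then have P: "P = ?C" by (simp add: d_def)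
  then have "R\<^sup>2 = (osculating_radius \<alpha> s)\<^sup>2" using c1 c2 by simp
  then show ?thesis using P R osculating_sphere_contact(1)[OF s]
    by (simp add: power2_eq_iff_nonneg)
qed

end

end

theory Submission
  imports Defs
begin

text \<open>The squared distance \<open>|\<alpha> - a\<^sub>0|\<^sup>2\<close> to the centre of the osculating sphere is constant to third
  order at \<open>s\<^sub>0\<close>, hence so is the factor \<open>r\<^sub>0 / |\<alpha> - a\<^sub>0|\<close>, which equals \<open>1\<close> there. So \<open>\<beta>\<close> and \<open>\<alpha>\<close> have the
  same derivatives up to order 3 at \<open>s\<^sub>0\<close>, and curvature and torsion depend only on these. The
  formulas for \<open>\<kappa>\<close> and \<open>\<tau>\<close> follow by expanding \<open>\<alpha> - P\<close> in the basis \<open>\<alpha>', \<alpha>'', \<alpha>' \<times> \<alpha>''\<close>.\<close>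

section \<open>Frenet apparatus of a regular curve in an arbitrary parameter\<close>

lemma has_real_derivative_norm:
  fixes f :: "real \<Rightarrow> 'a::real_inner"
  assumes "(f has_vector_derivative f') (at t)" "f t \<noteq> 0"
  shows "((\<lambda>u. norm (f u)) has_real_derivative (f t \<bullet> f') / norm (f t)) (at t)"
proof -
  have "f t \<bullet> f t > 0" using assms(2) by simp
  then have "((\<lambda>u. sqrt (f u \<bullet> f u)) has_real_derivative (f t \<bullet> f') / norm (f t)) (at t)"
    by (auto intro!: derivative_eq_intros has_real_derivative_inner assms(1)
        simp: norm_eq_sqrt_inner inner_commute field_simps simp del: inner_gt_zero_iff)
  then show ?thesis by (simp add: norm_eq_sqrt_inner)
qed

text \<open>For \<open>torsion_regular\<close>: non-vanishing is assumed there at one point only,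
  while \<open>binormal\<close> must be known on a neighbourhood before it can be
  differentiated.\<close>

lemma has_vector_derivative_open_nonzero:
  fixes f :: "real \<Rightarrow> 'a::real_normed_vector"
  assumes "(f has_vector_derivative f') (at t)" "f t \<noteq> 0"
  obtains U where "open U" "t \<in> U" "\<And>u. u \<in> U \<Longrightarrow> f u \<noteq> 0"
proof -
  have "isCont f t" using assms(1) by (rule has_vector_derivative_continuous)
  then have "eventually (\<lambda>u. f u \<noteq> 0) (at t)"
    using assms(2) by (simp add: isCont_def tendsto_imp_eventually_ne)
  then have "eventually (\<lambda>u. f u \<noteq> 0) (nhds t)"
    using assms(2) by (simp add: eventually_nhds_conv_at)
  then show ?thesis using that by (auto simp: eventually_nhds)
qed

lemma tangent_regular:
  assumes "(\<gamma> has_vector_derivative v) (at t)"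
  shows "tangent \<gamma> t = v /\<^sub>R norm v"
  using assms by (simp add: tangent_def arc_deriv_def vderiv_eqI)

text \<open>The quotient rule leaves the part of the acceleration orthogonal to the velocity. As a
  double cross product, its norm and its products with \<open>v t\<close> are easy to read
  off.\<close>

lemma arc_deriv_tangent_regular:
  fixes \<gamma> v :: "real \<Rightarrow> real^3" and a :: "real^3"
  assumes S: "open S" "t \<in> S"
    and d1: "\<And>u. u \<in> S \<Longrightarrow> (\<gamma> has_vector_derivative v u) (at u)"
    and d2: "(v has_vector_derivative a) (at t)" and nz: "v t \<noteq> 0"
  shows "arc_deriv \<gamma> (tangent \<gamma>) t = (1 / norm (v t) ^ 4) *\<^sub>R ((v t \<times> a) \<times> v t)"
proof -
  let ?n = "norm (v t)"
  have n: "?n > 0" using nz by simp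
  have "((\<lambda>u. 1 / norm (v u)) has_real_derivative - ((v t \<bullet> a) / ?n) / ?n\<^sup>2) (at t)"
    using n by (auto intro!: derivative_eq_intros has_real_derivative_norm d2 simp: power2_eq_square)
  from has_vector_derivative_scaleR[OF this d2]
  have "vderiv (\<lambda>u. (1 / norm (v u)) *\<^sub>R v u) t
      = (1 / ?n) *\<^sub>R a + (- ((v t \<bullet> a) / ?n) / ?n\<^sup>2) *\<^sub>R v t"
    by (rule vderiv_eqI)
  \<comment> \<open>Where \<open>v u = 0\<close>, both sides are zero because division by zero
    yields zero, so the formula holds on all of \<open>S\<close>.\<close>
  moreover have "vderiv (tangent \<gamma>) t = vderiv (\<lambda>u. (1 / norm (v u)) *\<^sub>R v u) t"
    by (rule vderiv_cong[OF S]) (simp add: tangent_regular[OF d1] divide_inverse)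
  ultimately have "arc_deriv \<gamma> (tangent \<gamma>) t
      = (1 / ?n\<^sup>2) *\<^sub>R a - ((v t \<bullet> a) / ?n ^ 4) *\<^sub>R v t"
    by (simp add: arc_deriv_def vderiv_eqI[OF d1[OF S(2)]] scaleR_add_right scaleR_diff_right
        divide_inverse power2_eq_square power4_eq_xxxx mult_ac)
  moreover have "(v t \<times> a) \<times> v t = ?n\<^sup>2 *\<^sub>R a - (v t \<bullet> a) *\<^sub>R v t"
    using Lagrange[of "v t" "v t" "a"] cross_skew[of "v t \<times> a" "v t"]
    by (simp add: power2_norm_eq_inner)
  ultimately show ?thesis
    using n by (simp add: scaleR_diff_right power2_eq_square power4_eq_xxxx)
qed

text \<open>The vectors \<open>v t \<times> a\<close> and \<open>v t\<close> are orthogonal, so the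
  norm of their cross product is the product of their norms.\<close>

lemma curvature_regular:
  fixes \<gamma> v :: "real \<Rightarrow> real^3" and a :: "real^3"
  assumes S: "open S" "t \<in> S"
    and d1: "\<And>u. u \<in> S \<Longrightarrow> (\<gamma> has_vector_derivative v u) (at u)"
    and d2: "(v has_vector_derivative a) (at t)" and nz: "v t \<noteq> 0"
  shows "curvature \<gamma> t = norm (v t \<times> a) / norm (v t) ^ 3"
proof -
  have "(norm ((v t \<times> a) \<times> v t))\<^sup>2 = (norm (v t \<times> a) * norm (v t))\<^sup>2"
    using norm_cross[of "v t \<times> a" "v t"] by (simp add: dot_cross_self power_mult_distrib)
  then have "norm ((v t \<times> a) \<times> v t) = norm (v t \<times> a) * norm (v t)"
    by (simp add: power2_eq_iff_nonneg)
  then show ?thesis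
    using nz by (simp add: curvature_def arc_deriv_tangent_regular[OF assms] power4_eq_xxxx power3_eq_cube)
qed

lemma normal_regular:
  fixes \<gamma> v :: "real \<Rightarrow> real^3" and a :: "real^3"
  assumes S: "open S" "t \<in> S"
    and d1: "\<And>u. u \<in> S \<Longrightarrow> (\<gamma> has_vector_derivative v u) (at u)"
    and d2: "(v has_vector_derivative a) (at t)" and nz: "v t \<noteq> 0"
  shows "normal \<gamma> t = (1 / (norm (v t) * norm (v t \<times> a))) *\<^sub>R ((v t \<times> a) \<times> v t)"
  using nz by (simp add: normal_def arc_deriv_tangent_regular[OF assms] curvature_regular[OF assms]
      power4_eq_xxxx power3_eq_cube field_simps)

lemma binormal_regular:
  fixes \<gamma> v :: "real \<Rightarrow> real^3" and a :: "real^3"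
  assumes S: "open S" "t \<in> S"
    and d1: "\<And>u. u \<in> S \<Longrightarrow> (\<gamma> has_vector_derivative v u) (at u)"
    and d2: "(v has_vector_derivative a) (at t)" and nz: "v t \<noteq> 0"
  shows "binormal \<gamma> t = (1 / norm (v t \<times> a)) *\<^sub>R (v t \<times> a)"
proof -
  have "v t \<times> ((v t \<times> a) \<times> v t) = (norm (v t))\<^sup>2 *\<^sub>R (v t \<times> a)"
    by (simp add: Lagrange dot_cross_self power2_norm_eq_inner)
  then show ?thesis
    using nz by (simp add: binormal_def tangent_regular[OF d1[OF S(2)]] normal_regular[OF assms]
        cross_mult_left cross_mult_right power2_eq_square field_simps)
qed

text \<open>The binormal points along \<open>v \<times> a\<close>, whose derivative is
  \<open>v \<times> j\<close> because \<open>a \<times> a\<close> vanishes. Pairing this with the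
  direction of the normal gives the triple product.\<close>

lemma torsion_regular:
  fixes \<gamma> v a :: "real \<Rightarrow> real^3"
  assumes S: "open S" "t \<in> S"
    and d1: "\<And>u. u \<in> S \<Longrightarrow> (\<gamma> has_vector_derivative v u) (at u)"
    and d2: "\<And>u. u \<in> S \<Longrightarrow> (v has_vector_derivative a u) (at u)"
    and d3: "(a has_vector_derivative j) (at t)"
    and nz: "v t \<times> a t \<noteq> 0"
  shows "torsion \<gamma> t = (v t \<times> a t) \<bullet> j / (norm (v t \<times> a t))\<^sup>2"
proof -
  let ?w = "\<lambda>u. v u \<times> a u"
  let ?n = "norm (?w t)" and ?m = "norm (v t)"
  have v: "v t \<noteq> 0" using nz by auto
  then obtain U where U: "open U" "t \<in> U" "\<And>u. u \<in> U \<Longrightarrow> v u \<noteq> 0"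
    using has_vector_derivative_open_nonzero[OF d2[OF S(2)]] by blast
  have dw: "(?w has_vector_derivative v t \<times> j) (at t)"
    using has_vector_derivative_cross[OF d2[OF S(2)] d3] by simp
  have "((\<lambda>u. 1 / norm (?w u)) has_real_derivative - ((?w t \<bullet> (v t \<times> j)) / ?n) / ?n\<^sup>2) (at t)"
    using nz by (auto intro!: derivative_eq_intros has_real_derivative_norm dw simp: power2_eq_square)
  \<comment> \<open>\<open>D\<close> can stay unspecified: it multiplies \<open>?w t\<close>, which
    is orthogonal to the normal direction \<open>?w t \<times> v t\<close>.\<close>
  then obtain D where "((\<lambda>u. 1 / norm (?w u)) has_real_derivative D) (at t)" by blast
  from has_vector_derivative_scaleR[OF this dw]
  have "vderiv (\<lambda>u. (1 / norm (?w u)) *\<^sub>R ?w u) t = (1 / ?n) *\<^sub>R (v t \<times> j) + D *\<^sub>R ?w t"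
    by (rule vderiv_eqI)
  moreover have "vderiv (binormal \<gamma>) t = vderiv (\<lambda>u. (1 / norm (?w u)) *\<^sub>R ?w u) t"
    using S U by (intro vderiv_cong[of "S \<inter> U"] binormal_regular[of S] d1 d2) auto
  ultimately have "torsion \<gamma> t
      = - (((1 / ?n) *\<^sub>R (v t \<times> j) + D *\<^sub>R ?w t) \<bullet> (?w t \<times> v t)) / (?m * (?m * ?n))"
    by (simp add: torsion_def arc_deriv_def normal_regular[OF S d1 d2[OF S(2)] v]
        vderiv_eqI[OF d1[OF S(2)]] divide_inverse mult_ac)
  also have "((1 / ?n) *\<^sub>R (v t \<times> j) + D *\<^sub>R ?w t) \<bullet> (?w t \<times> v t) = - (?m\<^sup>2 / ?n) * (?w t \<bullet> j)"
  proof -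
    \<comment> \<open>Of the two products that \<open>dot_cross\<close> yields, the one containing
      \<open>v t \<bullet> ?w t\<close> vanishes.\<close>
    have "(v t \<times> j) \<bullet> (?w t \<times> v t) = - ?m\<^sup>2 * (?w t \<bullet> j)"
      using dot_cross[of "v t" j "?w t" "v t"]
      by (simp add: dot_cross_self power2_norm_eq_inner inner_commute)
    then show ?thesis
      by (simp only: inner_add_left inner_scaleR_left dot_cross_self) simp
  qed
  finally show ?thesis
    using v nz by (simp add: power2_eq_square)
qed

section \<open>Functions that are flat to third order\<close>

text \<open>Every term in the first three derivatives of a power of \<open>g\<close> contains a
  derivative of \<open>g\<close> of order one to three, and these vanish at \<open>t\<close>. With a
  general real exponent, one power rule serves at each differentiation.\<close>

lemma flat_powr:
  fixes g g1 g2 :: "real \<Rightarrow> real" and p :: real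
  assumes S: "t \<in> S" and pos: "\<And>u. u \<in> S \<Longrightarrow> g u > 0"
    and d1: "\<And>u. u \<in> S \<Longrightarrow> (g has_real_derivative g1 u) (at u)"
    and d2: "\<And>u. u \<in> S \<Longrightarrow> (g1 has_real_derivative g2 u) (at u)"
    and d3: "(g2 has_real_derivative 0) (at t)"
    and z: "g1 t = 0" "g2 t = 0"
  obtains f1 f2 where "\<And>u. u \<in> S \<Longrightarrow> ((\<lambda>u. g u powr p) has_real_derivative f1 u) (at u)"
    "\<And>u. u \<in> S \<Longrightarrow> (f1 has_real_derivative f2 u) (at u)"
    "(f2 has_real_derivative 0) (at t)" "f1 t = 0" "f2 t = 0"
proof -
  have P: "((\<lambda>u. g u powr r) has_real_derivative r * g u powr (r - 1) * g1 u) (at u)" if "u \<in> S" for u r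
    using DERIV_fun_powr[OF d1[OF that] pos[OF that], of r] by simp
  let ?f1 = "\<lambda>u. p * g u powr (p - 1) * g1 u"
  let ?f2 = "\<lambda>u. p * ((p - 1) * g u powr (p - 1 - 1) * g1 u * g1 u + g u powr (p - 1) * g2 u)"
  show ?thesis
  proof (rule that[of ?f1 ?f2])
    show "(?f1 has_real_derivative ?f2 u) (at u)" if "u \<in> S" for u
      by (rule derivative_eq_intros P d2 that refl | simp add: algebra_simps)+
    show "(?f2 has_real_derivative 0) (at t)"
      by (rule derivative_eq_intros P d2 d3 S refl | simp add: z)+
  qed (use P z in auto)
qed

text \<open>In the Leibniz rule, every term other than \<open>f\<close> times a derivative of
  \<open>q\<close> carries a derivative of \<open>f\<close>, which is zero at \<open>t\<close>. The
  agreement holds at \<open>t\<close> only, so \<open>b1\<close> and \<open>b2\<close> are functions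
  of their own.\<close>

lemma flat_scaling:
  fixes q v1 v2 :: "real \<Rightarrow> 'a::real_normed_vector"
  assumes S: "t \<in> S"
    and f1: "\<And>u. u \<in> S \<Longrightarrow> (f has_real_derivative f1 u) (at u)"
    and f2: "\<And>u. u \<in> S \<Longrightarrow> (f1 has_real_derivative f2 u) (at u)"
    and f3: "(f2 has_real_derivative 0) (at t)"
    and z: "f t = 1" "f1 t = 0" "f2 t = 0"
    and q1: "\<And>u. u \<in> S \<Longrightarrow> (q has_vector_derivative v1 u) (at u)"
    and q2: "\<And>u. u \<in> S \<Longrightarrow> (v1 has_vector_derivative v2 u) (at u)"
    and q3: "(v2 has_vector_derivative v3) (at t)"
  obtains b1 b2 where "\<And>u. u \<in> S \<Longrightarrow> ((\<lambda>u. f u *\<^sub>R q u) has_vector_derivative b1 u) (at u)"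
    "\<And>u. u \<in> S \<Longrightarrow> (b1 has_vector_derivative b2 u) (at u)"
    "(b2 has_vector_derivative v3) (at t)" "b1 t = v1 t" "b2 t = v2 t"
proof -
  let ?b1 = "\<lambda>u. f u *\<^sub>R v1 u + f1 u *\<^sub>R q u"
  let ?b2 = "\<lambda>u. (f u *\<^sub>R v2 u + f1 u *\<^sub>R v1 u) + (f1 u *\<^sub>R v1 u + f2 u *\<^sub>R q u)"
  have "(?b2 has_vector_derivative (f t *\<^sub>R v3 + f1 t *\<^sub>R v2 t + (f1 t *\<^sub>R v2 t + f2 t *\<^sub>R v1 t))
      + ((f1 t *\<^sub>R v2 t + f2 t *\<^sub>R v1 t) + (f2 t *\<^sub>R v1 t + 0 *\<^sub>R q t))) (at t)"
    by (intro has_vector_derivative_add has_vector_derivative_scaleR f1 f2 f3 q1 q2 q3 S)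
  then have "(?b2 has_vector_derivative v3) (at t)" by (simp add: z)
  then show ?thesis
    by (intro that[of ?b1 ?b2] has_vector_derivative_add has_vector_derivative_scaleR f1 f2 q1 q2)
       (auto simp: z)
qed

section \<open>Curvature and torsion in terms of J\<close>

context twisted_unit_speed
begin

abbreviation "q s \<equiv> \<alpha> s - osculating_center \<alpha> s"

text \<open>Together with the positivity of the radius, these contact equations are all that is used
  of the osculating sphere below; the explicit formula for its center is not unfolded again.\<close>

lemma q_inner:
  assumes "s \<in> I"
  shows "(norm (q s))\<^sup>2 = (osculating_radius \<alpha> s)\<^sup>2" "q s \<bullet> v1 s = 0" "q s \<bullet> v2 s = - 1" "q s \<bullet> v3 s = 0"
  using osculating_sphere_contact(2)[OF assms] by (auto simp: contact_iff assms)

lemma norm_cross_v12: "s \<in> I \<Longrightarrow> norm (v1 s \<times> v2 s) = norm (v2 s)"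
  using norm_cross[of "v1 s" "v2 s"] unit by (simp add: v12)

text \<open>In the orthogonal basis \<open>v1 s\<close>, \<open>v2 s\<close>,
  \<open>v1 s \<times> v2 s\<close>, the last two vectors have norm \<kappa>, and
  \<open>q_inner\<close> and the definition of J supply the coefficients. Pairing this identity with
  suitable vectors yields the formulas below.\<close>

lemma q_expansion:
  assumes s: "s \<in> I"
  shows "(norm (v2 s))\<^sup>2 *\<^sub>R q s = osculating_J \<alpha> s *\<^sub>R (v1 s \<times> v2 s) - v2 s"
proof -
  let ?w = "v1 s \<times> v2 s"
  have w: "?w \<times> v1 s = v2 s"
    using Lagrange[of "v1 s" "v1 s" "v2 s"] cross_skew[of ?w "v1 s"] v11[OF s] v12[OF s] by simp
  \<comment> \<open>This splits \<open>q s\<close> into its component along \<open>?w\<close> and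
    the one orthogonal to it.\<close>
  have "(norm ?w)\<^sup>2 *\<^sub>R q s = (q s \<bullet> ?w) *\<^sub>R ?w - ?w \<times> (?w \<times> q s)"
    by (simp add: Lagrange power2_norm_eq_inner inner_commute)
  also have "?w \<times> q s = v1 s"
    using Lagrange[of "q s" "v1 s" "v2 s"] cross_skew[of ?w "q s"] q_inner[OF s] by simp
  finally show ?thesis
    by (simp add: norm_cross_v12[OF s] osculating_J_def w)
qed

text \<open>Pairing the expansion with \<open>v3 s\<close> kills its left side by third-order
  contact. As the left side here is \<kappa>\<kappa>', this reads \<kappa>' =
  J\<kappa>\<tau>.\<close>

lemma v23_eq:
  assumes s: "s \<in> I"
  shows "v2 s \<bullet> v3 s = osculating_J \<alpha> s * ((v1 s \<times> v2 s) \<bullet> v3 s)"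
  using arg_cong[OF q_expansion[OF s], of "\<lambda>x. x \<bullet> v3 s"] q_inner(4)[OF s]
  by (simp add: inner_diff_left)

lemma curvature_via_J:
  assumes s: "s \<in> I"
  shows "curvature \<alpha> s = 1 / osculating_radius \<alpha> s * sqrt (1 + (osculating_J \<alpha> s)\<^sup>2)"
proof -
  let ?J = "osculating_J \<alpha> s" and ?k = "norm (v2 s)" and ?R = "osculating_radius \<alpha> s"
  \<comment> \<open>Here the expansion is paired with \<open>q s\<close> itself.\<close>
  have "?k\<^sup>2 * ?R\<^sup>2 = ?k\<^sup>2 *\<^sub>R q s \<bullet> q s"
    using q_inner(1)[OF s] by (simp add: power2_norm_eq_inner)
  also have "\<dots> = 1 + ?J\<^sup>2"
    using q_inner(3)[OF s] inner_commute[of "v2 s" "q s"] inner_commute[of "v1 s \<times> v2 s" "q s"]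
    by (simp only: q_expansion[OF s] inner_diff_left[of "_ *\<^sub>R _"] inner_scaleR_left)
       (simp only: osculating_J_def power2_eq_square add.commute diff_minus_eq_add)
  finally have "sqrt (1 + ?J\<^sup>2) = ?k * ?R"
    using osculating_sphere_contact(1)[OF s] by (metis norm_ge_zero less_imp_le mult_nonneg_nonneg
        power_mult_distrib real_sqrt_unique)
  then show ?thesis
    using osculating_sphere_contact(1)[OF s] by (simp add: curvature_eq[OF s])
qed

lemma torsion_via_J:
  assumes s: "s \<in> I"
  shows "torsion \<alpha> s = (q s \<bullet> (v1 s \<times> v3 s)) / (1 + (osculating_J \<alpha> s)\<^sup>2)"
proof -
  let ?J = "osculating_J \<alpha> s" and ?k = "norm (v2 s)" and ?D = "(v1 s \<times> v2 s) \<bullet> v3 s"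
  have "v2 s \<bullet> (v1 s \<times> v3 s) = - ?D" by (simp add: cross3_simps)
  moreover have "(v1 s \<times> v2 s) \<bullet> (v1 s \<times> v3 s) = ?J * ?D"
    using v11[OF s] v12[OF s] v23_eq[OF s] by (simp add: dot_cross inner_commute)
  ultimately have "?k\<^sup>2 * (q s \<bullet> (v1 s \<times> v3 s)) = ?D * (1 + ?J\<^sup>2)"
    using arg_cong[OF q_expansion[OF s], of "\<lambda>x. x \<bullet> (v1 s \<times> v3 s)"]
    by (simp add: inner_diff_left power2_eq_square algebra_simps)
  moreover have "1 + ?J\<^sup>2 > 0" by (simp add: add_pos_nonneg)
  ultimately show ?thesis
    using v2_pos[OF s] by (simp add: torsion_eq[OF s] field_simps)
qed

lemma J_eq:
  assumes s: "s \<in> I"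
  shows "osculating_J \<alpha> s = - norm (v2 s) * (vderiv (curvature_radius \<alpha>) s / torsion \<alpha> s)"
proof -
  have "vderiv (curvature_radius \<alpha>) s
      = - (osculating_J \<alpha> s * ((v1 s \<times> v2 s) \<bullet> v3 s)) / norm (v2 s) ^ 3"
    using dradius[OF s] by (simp add: arc[OF s] v23_eq[OF s])
  then show ?thesis
    using triple_nz[OF s] v2_pos[OF s]
    by (simp add: torsion_eq[OF s] power2_eq_square power3_eq_cube)
qed

lemma torsion_via_J_deriv:
  assumes s: "s \<in> I"
    and diff: "(\<lambda>s. vderiv (curvature_radius \<alpha>) s / torsion \<alpha> s) differentiable (at s)"
  shows "osculating_J \<alpha> differentiable (at s)"
    and "torsion \<alpha> s = vderiv (osculating_J \<alpha>) s / (1 + (osculating_J \<alpha> s)\<^sup>2)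
          + curvature \<alpha> s * varsigma \<alpha> s / (1 + (osculating_J \<alpha> s)\<^sup>2)"
proof -
  let ?c = "\<lambda>s. vderiv (curvature_radius \<alpha>) s / torsion \<alpha> s"
  let ?J = "osculating_J \<alpha> s" and ?k = "norm (v2 s)" and ?D = "(v1 s \<times> v2 s) \<bullet> v3 s"
  have dc: "(?c has_real_derivative vderiv ?c s) (at s)"
    using has_vector_derivative_vderiv[OF diff]
    by (simp only: has_real_derivative_iff_has_vector_derivative)
  have "((\<lambda>u. - norm (v2 u) * ?c u) has_real_derivative
      - ((v2 s \<bullet> v3 s) / ?k) * ?c s + - ?k * vderiv ?c s) (at s)"
    by (rule derivative_eq_intros dnorm2 dc s refl | simp)+
  then have dJ: "(osculating_J \<alpha> has_real_derivative
      - ((v2 s \<bullet> v3 s) / ?k) * ?c s + - ?k * vderiv ?c s) (at s)"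
    by (rule has_field_derivative_transform_within_open[OF _ I s]) (simp add: J_eq)
  then show "osculating_J \<alpha> differentiable (at s)"
    using real_differentiable_def by blast
  have "arc_deriv \<alpha> (\<lambda>u. arc_deriv \<alpha> (curvature_radius \<alpha>) u / torsion \<alpha> u) s = vderiv ?c s"
    unfolding arc[OF s] by (rule vderiv_cong[OF I s]) (simp add: arc)
  then have "curvature \<alpha> s * varsigma \<alpha> s = torsion \<alpha> s + ?k * vderiv ?c s"
    using v2_pos[OF s] by (simp add: varsigma_def curvature_radius_def curvature_eq[OF s] field_simps)
  moreover have "vderiv (osculating_J \<alpha>) s = - ((v2 s \<bullet> v3 s) / ?k) * ?c s + - ?k * vderiv ?c s"
    using dJ by (intro vderiv_eqI) (simp only: has_real_derivative_iff_has_vector_derivative)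
  moreover have "- ((v2 s \<bullet> v3 s) / ?k) * ?c s = torsion \<alpha> s * ?J\<^sup>2"
  proof -
    have "?c s = - (?J / ?k)" using J_eq[OF s] v2_pos[OF s] by (simp add: field_simps)
    then show ?thesis
      by (simp add: v23_eq[OF s] torsion_eq[OF s] power2_eq_square)
  qed
  ultimately have "vderiv (osculating_J \<alpha>) s + curvature \<alpha> s * varsigma \<alpha> s
      = torsion \<alpha> s * (1 + ?J\<^sup>2)"
    by (simp add: algebra_simps)
  moreover have "1 + ?J\<^sup>2 > 0" by (simp add: add_pos_nonneg)
  ultimately show "torsion \<alpha> s = vderiv (osculating_J \<alpha>) s / (1 + ?J\<^sup>2)
          + curvature \<alpha> s * varsigma \<alpha> s / (1 + ?J\<^sup>2)"
    by (simp add: add_divide_distrib[symmetric])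
qed

section \<open>Projection onto the osculating sphere\<close>

lemma osculating_projection_curvature_torsion:
  fixes \<beta> :: "real \<Rightarrow> real^3"
  assumes S: "open S" "S \<subseteq> I" "s \<in> S"
    and P: "P = osculating_center \<alpha> s" and R: "R = osculating_radius \<alpha> s"
    and ne: "\<And>t. t \<in> S \<Longrightarrow> \<alpha> t \<noteq> P"
    and \<beta>: "\<And>t. t \<in> S \<Longrightarrow> \<beta> t = P + R *\<^sub>R ((\<alpha> t - P) /\<^sub>R norm (\<alpha> t - P))"
  shows "curvature \<beta> s = curvature \<alpha> s" "torsion \<beta> s = torsion \<alpha> s"
proof -
  have s: "s \<in> I" and SI: "\<And>u. u \<in> S \<Longrightarrow> u \<in> I" using S by auto
  \<comment> \<open>The center is frozen at \<open>P\<close>, whereas in \<open>q\<close> it moves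
    with the parameter; the two agree at \<open>s\<close>.\<close>
  let ?q = "\<lambda>u. \<alpha> u - P"
  let ?g = "\<lambda>u. ?q u \<bullet> ?q u"
  have dq: "(?q has_vector_derivative v1 u) (at u)" if "u \<in> S" for u
    using has_vector_derivative_diff[OF d1[OF SI[OF that]] has_vector_derivative_const[of P]] by simp
  have g1: "(?g has_real_derivative 2 * (?q u \<bullet> v1 u)) (at u)" if "u \<in> S" for u
    using has_real_derivative_inner[OF dq[OF that] dq[OF that]] by (simp add: inner_commute)
  have g2: "((\<lambda>u. 2 * (?q u \<bullet> v1 u)) has_real_derivative 2 * (?q u \<bullet> v2 u + 1)) (at u)"
    if "u \<in> S" for u
    using DERIV_cmult[OF has_real_derivative_inner[OF dq[OF that] d2[OF SI[OF that]]], of 2]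
    by (simp only: v11[OF SI[OF that]])
  have g3: "((\<lambda>u. 2 * (?q u \<bullet> v2 u + 1)) has_real_derivative 0) (at s)"
    using DERIV_cmult[OF DERIV_add[OF has_real_derivative_inner[OF dq[OF S(3)] d3[OF s]]
          DERIV_const[of 1]], of 2]
    by (simp add: v12[OF s] P q_inner[OF s])
  have gpos: "?g u > 0" if "u \<in> S" for u using ne[OF that] by simp
  have z: "2 * (?q s \<bullet> v1 s) = 0" "2 * (?q s \<bullet> v2 s + 1) = 0"
    by (simp_all only: P q_inner[OF s]) simp_all
  \<comment> \<open>The exponent -1/2 turns the squared distance \<open>?g\<close> into the
    reciprocal distance.\<close>
  obtain h1 h2 where h: "\<And>u. u \<in> S \<Longrightarrow> ((\<lambda>u. ?g u powr (-1/2)) has_real_derivative h1 u) (at u)"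
    "\<And>u. u \<in> S \<Longrightarrow> (h1 has_real_derivative h2 u) (at u)"
    "(h2 has_real_derivative 0) (at s)" "h1 s = 0" "h2 s = 0"
    by (rule flat_powr[OF S(3) gpos g1 g2 g3 z, where p = "-1/2"], assumption+) (rule that)
  have pw: "?g u powr (-1/2) = 1 / norm (?q u)" if "u \<in> S" for u
  proof -
    have "?g u powr (-1/2) = inverse (?g u powr (1/2))"
      using powr_minus[of "?g u" "1/2"] by simp
    also have "?g u powr (1/2) = norm (?q u)"
      unfolding norm_eq_sqrt_inner by (rule powr_half_sqrt) (rule inner_ge_zero)
    finally show ?thesis by (simp only: inverse_eq_divide)
  qed
  let ?f = "\<lambda>u. R * ?g u powr (-1/2)"
  have f1: "(?f has_real_derivative R * h1 u) (at u)"
    and f2: "((\<lambda>u. R * h1 u) has_real_derivative R * h2 u) (at u)" if "u \<in> S" for u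
    by (rule DERIV_cmult[OF h(1)[OF that]], rule DERIV_cmult[OF h(2)[OF that]])
  have f3: "((\<lambda>u. R * h2 u) has_real_derivative 0) (at s)"
    using DERIV_cmult[OF h(3), of R] by simp
  have Rpos: "R > 0" using osculating_sphere_contact(1)[OF s] R by simp
  have "norm (?q s) = R"
    using q_inner(1)[OF s] Rpos by (simp add: P R power2_eq_iff_nonneg)
  then have fs: "?f s = 1" using pw[OF S(3)] Rpos by simp
  have fz: "R * h1 s = 0" "R * h2 s = 0" by (simp_all add: h)
  obtain b1 b2 where b: "\<And>u. u \<in> S \<Longrightarrow> ((\<lambda>u. ?f u *\<^sub>R ?q u) has_vector_derivative b1 u) (at u)"
    "\<And>u. u \<in> S \<Longrightarrow> (b1 has_vector_derivative b2 u) (at u)"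
    "(b2 has_vector_derivative v3 s) (at s)" "b1 s = v1 s" "b2 s = v2 s"
    by (rule flat_scaling[OF S(3) f1 f2 f3 fs fz dq d2[OF SI] d3[OF s]], assumption+) (rule that)
  have \<beta>1: "(\<beta> has_vector_derivative b1 u) (at u)" if "u \<in> S" for u
  proof (rule has_vector_derivative_transform_within_open[OF _ S(1) that])
    show "((\<lambda>u. P + ?f u *\<^sub>R ?q u) has_vector_derivative b1 u) (at u)"
      using has_vector_derivative_add[OF has_vector_derivative_const b(1)[OF that]] by simp
    show "P + ?f x *\<^sub>R ?q x = \<beta> x" if "x \<in> S" for x
      by (simp only: pw[OF that] \<beta>[OF that]) (simp add: divide_inverse)
  qed
  \<comment> \<open>Since \<open>b1\<close> and \<open>b2\<close> take the values
    \<open>v1 s\<close> and \<open>v2 s\<close> at \<open>s\<close>, this gives the non-degeneracy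
    for both curves.\<close>
  have "norm (v1 s \<times> v2 s) \<noteq> 0" using norm_cross_v12[OF s] v2_pos[OF s] by simp
  then have w: "v1 s \<times> v2 s \<noteq> 0" by simp
  then have v: "v1 s \<noteq> 0" by auto
  show "curvature \<beta> s = curvature \<alpha> s"
    using curvature_regular[OF S(1,3) \<beta>1 b(2)[OF S(3)]] curvature_regular[OF I s d1 d2[OF s]] v
    by (simp add: b(4,5))
  show "torsion \<beta> s = torsion \<alpha> s"
    using torsion_regular[OF S(1,3) \<beta>1 b(2,3)] torsion_regular[OF I s d1 d2 d3[OF s]] w
    by (simp add: b(4,5))
qed

end

theorem mainTheorem5:
  fixes \<alpha> \<beta> :: "real \<Rightarrow> real^3" and I :: "real set" and s0 \<epsilon> r0 :: real and a0 :: "real^3"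
  assumes "open I" and "is_interval I"
    and "Ck_on 3 \<alpha> I"
    and "\<forall>s\<in>I. norm (vderiv \<alpha> s) = 1"
    and "\<forall>s\<in>I. curvature \<alpha> s > 0 \<and> torsion \<alpha> s \<noteq> 0"
    and "s0 \<in> I"
    and "a0 = osculating_center \<alpha> s0" and "r0 = osculating_radius \<alpha> s0"
    and "\<epsilon> > 0" and "{s0 - \<epsilon><..<s0 + \<epsilon>} \<subseteq> I"
    and "\<forall>t\<in>{s0 - \<epsilon><..<s0 + \<epsilon>}. \<alpha> t \<noteq> a0"
    and "\<forall>t\<in>{s0 - \<epsilon><..<s0 + \<epsilon>}. \<beta> t = a0 + r0 *\<^sub>R ((\<alpha> t - a0) /\<^sub>R norm (\<alpha> t - a0))"
  shows "curvature \<alpha> s0 = curvature \<beta> s0 \<and> torsion \<alpha> s0 = torsion \<beta> s0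
    \<and> curvature \<alpha> s0 = 1 / osculating_radius \<alpha> s0 * sqrt (1 + (osculating_J \<alpha> s0)\<^sup>2)
    \<and> torsion \<alpha> s0 =
        ((\<alpha> s0 - osculating_center \<alpha> s0) \<bullet> (vderiv \<alpha> s0 \<times> vderiv (vderiv (vderiv \<alpha>)) s0))
          / (1 + (osculating_J \<alpha> s0)\<^sup>2)
    \<and> ((\<lambda>s. vderiv (curvature_radius \<alpha>) s / torsion \<alpha> s) differentiable (at s0) \<longrightarrow>
        osculating_J \<alpha> differentiable (at s0) \<and>
        torsion \<alpha> s0 =
          vderiv (osculating_J \<alpha>) s0 / (1 + (osculating_J \<alpha> s0)\<^sup>2)
          + curvature \<alpha> s0 * varsigma \<alpha> s0 / (1 + (osculating_J \<alpha> s0)\<^sup>2))"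
proof -
  interpret twisted_unit_speed \<alpha> I
    using assms by unfold_locales auto
  have "s0 \<in> {s0 - \<epsilon><..<s0 + \<epsilon>}" using assms(9) by simp
  then have "curvature \<beta> s0 = curvature \<alpha> s0" "torsion \<beta> s0 = torsion \<alpha> s0"
    using osculating_projection_curvature_torsion[of "{s0 - \<epsilon><..<s0 + \<epsilon>}" s0 a0 r0 \<beta>] assms(7-)
    by auto
  then show ?thesis
    by (intro conjI impI curvature_via_J torsion_via_J torsion_via_J_deriv assms(6)) simp_all
qed

end
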